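(* Let $\mathcal{M}=\{v_i\mid 1\leq i\leq 6\}\subset\mathbb{R}^2$ be a generic set of six vectors such that the six-line arrangements with normal vectors $v_1,\ldots,v_6$ consist of three pairs of mutually perpendicular lines (that is, the index set $\{1,\ldots,6\}$ can be partitioned into three pairs $\{i,j\}$ with $v_i\cdot v_j=0$ for each pair). Then $\mathcal{M}$ is not very generic, that is, the discriminantal arrangement to which it gives rise is not a very generic (equivalently, "sufficiently general") discriminantal arrangement.
   Context: Let $m,n$ be positive integers with $n>m$. A finite set $\{v_i=(a_{i1},\ldots,a_{im})\mid 1\le i\le n\}\subset\mathbb{R}^m$ is generic if every subset of cardinality at most $m$ is linearly independent; equivalently (for $n\ge m$) all $m\times m$ minors of the $n\times m$ matrix $A=[a_{ij}]$ are nonzero. For an $(m+1)$-subset $S=\{i_1<\cdots<i_{m+1}\}$ of $\{1,\ldots,n\}$ and an $n\times m$ matrix $X=[x_{ij}]$, let $L_{S,X}(y_1,\ldots,y_n)$ be the determinant of the $(m+1)\times(m+1)$ matrix whose $t$-th row is $(x_{i_t1},x_{i_t2},\ldots,x_{i_tm},y_{i_t})$; it is a linear form in $y_1,\ldots,y_n$. The discriminantal arrangement associated with $A$ is the central arrangement $\{M_S\}_S$ in $\mathbb{R}^n$, where $M_S=\{y\in\mathbb{R}^n\mid L_{S,A}(y)=0\}$ and $S$ runs over all $(m+1)$-subsets. Let $\mathrm{Disc}(X)$ be the $\binom{n}{m+1}\times n$ matrix whose row indexed by $S$ is the coefficient vector of $L_{S,X}$. For a collection $\mathcal{S}=\{S_1,\ldots,S_l\}$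 of distinct $(m+1)$-subsets of $\{1,\ldots,n\}$, let $P_{\mathcal{S}}(X)$ be the sum of the squares of all $l\times l$ minors of the $l\times n$ submatrix of $\mathrm{Disc}(X)$ given by the rows $S_1,\ldots,S_l$; with $X$ a matrix of indeterminates it is a polynomial in the $x_{ij}$. A generic set with matrix $A$ is called very generic, and its discriminantal arrangement very generic (or sufficiently general), if $P_{\mathcal{S}}(A)\neq0$ for every $\mathcal{S}$ for which $P_{\mathcal{S}}(X)$ is not the zero polynomial. Here $m=2$, $n=6$. A six-line arrangement with normals $v_i=(a_{i1},a_{i2})$ is $\{L_i: a_{i1}x_1+a_{i2}x_2=b_i\mid 1\le i\le 6\}$ with $b_i\in\mathbb{R}$. *)

theory Defs
  imports
    "HOL-Library.Poly_Mapping"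
    "HOL-Library.Disjoint_Sets"
    "Jordan_Normal_Form.Determinant"
    "Jordan_Normal_Form.VS_Connect"
    "Jordan_Normal_Form.DL_Submatrix"
begin

(* An indexed set {v_1,...,v_n} of n vectors in R^m is given by the n x m matrix A whose rows are
   the v_i.  As for all matrices of this library, indices start at 0. *)

definition generic :: "real mat \<Rightarrow> bool" where
  "generic A \<longleftrightarrow> distinct (rows A) \<and>
     (\<forall>T \<subseteq> set (rows A). card T \<le> dim_col A \<longrightarrow>
        \<not> LinearCombinations.module.lin_dep class_ring (module_vec TYPE(real) (dim_col A)) T)"

definition index_sets :: "nat \<Rightarrow> nat \<Rightarrow> nat set set" where
  "index_sets n k = {S. S \<subseteq> {..<n} \<and> card S = k}"

(* L_{S,X}(y): pick S t is the t-th smallest element of S.  The entries live in an arbitrary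
   commutative ring, so that X may be a real matrix or a matrix of indeterminates. *)
definition disc_form :: "'a :: comm_ring_1 mat \<Rightarrow> nat set \<Rightarrow> 'a vec \<Rightarrow> 'a" where
  "disc_form X S y = det (mat (dim_col X + 1) (dim_col X + 1)
     (\<lambda>(t, j). if j < dim_col X then X $$ (pick S t, j) else y $ pick S t))"

(* The coefficient of y_k in the linear form L_{S,X} is its value at the k-th unit vector. *)
definition disc_row :: "'a :: comm_ring_1 mat \<Rightarrow> nat set \<Rightarrow> 'a vec" where
  "disc_row X S = vec (dim_row X) (\<lambda>k. disc_form X S (unit_vec (dim_row X) k))"

(* The l x n submatrix of Disc(X) on the rows S_1,...,S_l. *)
definition disc_submatrix :: "'a :: comm_ring_1 mat \<Rightarrow> nat set list \<Rightarrow> 'a mat" where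
  "disc_submatrix X Ss = mat_of_rows (dim_row X) (map (disc_row X) Ss)"

(* P_{S_1,...,S_l}(X).  The collection is given as a list, but the order is immaterial: permuting
   the rows only changes signs of minors. *)
definition sum_sq_minors :: "'a :: comm_ring_1 mat \<Rightarrow> nat set list \<Rightarrow> 'a" where
  "sum_sq_minors X Ss = (\<Sum>J \<in> index_sets (dim_row X) (length Ss).
     (det (submatrix (disc_submatrix X Ss) UNIV J))\<^sup>2)"

(* Real multivariate polynomials in indeterminates x_{ij}: finitely supported maps from monomials
   (finitely supported exponent functions) to coefficients, with convolution as product. *)
type_synonym mat_poly = "(nat \<times> nat \<Rightarrow>\<^sub>0 nat) \<Rightarrow>\<^sub>0 real"

definition indet :: "nat \<times> nat \<Rightarrow> mat_poly" where
  "indet ij = Poly_Mapping.single (Poly_Mapping.single ij 1) 1"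

definition indet_mat :: "nat \<Rightarrow> nat \<Rightarrow> mat_poly mat" where
  "indet_mat n m = mat n m indet"

(* This is by definition also the property that the discriminantal arrangement associated with A
   is very generic (= sufficiently general). *)
definition very_generic :: "real mat \<Rightarrow> bool" where
  "very_generic A \<longleftrightarrow> generic A \<and>
     (\<forall>Ss. distinct Ss \<longrightarrow> set Ss \<subseteq> index_sets (dim_row A) (dim_col A + 1) \<longrightarrow>
        sum_sq_minors (indet_mat (dim_row A) (dim_col A)) Ss \<noteq> 0 \<longrightarrow>
        sum_sq_minors A Ss \<noteq> 0)"

definition three_perpendicular_pairs :: "real mat \<Rightarrow> bool" where
  "three_perpendicular_pairs A \<longleftrightarrow>
     (\<exists>Q. partition_on {..<dim_row A} Q \<and> card Q = 3 \<and>
        (\<forall>p\<in>Q. \<exists>i j. i \<noteq> j \<and> p = {i, j} \<and> row A i \<bullet> row A j = 0))"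

end

theory Submission
  imports Defs
begin

text \<open>
  The reason is that the three altitudes of a triangle meet in a point. Take one line from each
  perpendicular pair as a side of a triangle and its partner as the altitude on that side. The six
  lines of the triangle with its orthocentre pass by threes through four points: the three vertices
  (two sides and one altitude each) and the orthocentre (three altitudes). For normals in general
  position the four corresponding concurrency conditions on the right-hand sides are independent;
  for perpendicular pairs the fourth follows from the other three, so the four rows of the
  discriminantal matrix become linearly dependent and all their maximal minors vanish.

  The dependence is explicit. Write \<open>[u, v]\<close> for the determinant of two plane vectors and \<open>J\<close> for
  the rotation by a right angle. As \<open>[J u, J v] = [u, v]\<close> and \<open>[u, J v] = - [J u, v]\<close> is symmetric
  in \<open>u\<close> and \<open>v\<close>, the conditions at the three vertices add up to the condition at the orthocentre
  when the altitudes have normals \<open>J u\<close>, \<open>J v\<close>, \<open>J w\<close>; for multiples of these vectors the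
  summands acquire weights (\<open>altitude_relation\<close>).

  Independence for indeterminate normals follows by specialisation: evaluation at a real matrix is
  a ring homomorphism, and a ring homomorphism commutes with the formation of \<open>sum_sq_minors\<close>, so a
  single matrix with a nonzero value suffices (\<open>sum_sq_minors_altitude_triples_indet_mat\<close>). Both
  halves use that, over the reals, \<open>sum_sq_minors\<close> vanishes exactly if the rows are dependent on
  every set of columns of the right size (\<open>sum_sq_minors_eq_zero_iff\<close>).
\<close>

section \<open>Evaluation of multivariate polynomials\<close>

definition monom_value :: "('v \<Rightarrow> 'a) \<Rightarrow> ('v \<Rightarrow>\<^sub>0 nat) \<Rightarrow> 'a :: comm_ring_1" where
  "monom_value x m = (\<Prod>v\<in>Poly_Mapping.keys m. x v ^ Poly_Mapping.lookup m v)"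

definition poly_value :: "('v \<Rightarrow> 'a) \<Rightarrow> (('v \<Rightarrow>\<^sub>0 nat) \<Rightarrow>\<^sub>0 'a) \<Rightarrow> 'a :: comm_ring_1" where
  "poly_value x p = (\<Sum>m\<in>Poly_Mapping.keys p. Poly_Mapping.lookup p m * monom_value x m)"

lemma monom_value_superset:
  assumes "finite V" "Poly_Mapping.keys m \<subseteq> V"
  shows "monom_value x m = (\<Prod>v\<in>V. x v ^ Poly_Mapping.lookup m v)"
  unfolding monom_value_def
  by (rule prod.mono_neutral_left) (use assms in \<open>auto simp: in_keys_iff\<close>)

lemma monom_value_add: "monom_value x (m + m') = monom_value x m * monom_value x m'"
proof -
  let ?V = "Poly_Mapping.keys m \<union> Poly_Mapping.keys m'"
  have "monom_value x (m + m') = (\<Prod>v\<in>?V. x v ^ Poly_Mapping.lookup (m + m') v)"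
    by (rule monom_value_superset) (simp_all add: keys_add)
  also have "\<dots> = (\<Prod>v\<in>?V. x v ^ Poly_Mapping.lookup m v) * (\<Prod>v\<in>?V. x v ^ Poly_Mapping.lookup m' v)"
    by (simp add: lookup_add power_add prod.distrib)
  also have "\<dots> = monom_value x m * monom_value x m'"
    by (simp add: monom_value_superset[of ?V m] monom_value_superset[of ?V m'])
  finally show ?thesis .
qed

lemma poly_value_add: "poly_value x (p + q) = poly_value x p + poly_value x q"
  unfolding poly_value_def
  by (rule setsum_keys_plus_distrib) (simp_all add: distrib_right)

lemma poly_value_single: "poly_value x (Poly_Mapping.single m c) = c * monom_value x m"
  by (cases "c = 0") (simp_all add: poly_value_def)

lemma poly_mapping_add_single_induct [case_names zero add]:
  assumes "P 0" "\<And>m c p. P p \<Longrightarrow> P (Poly_Mapping.single m c + p)"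
  shows "P (p :: 'k \<Rightarrow>\<^sub>0 'a :: comm_monoid_add)"
proof (induction p rule: update_induct)
  case const
  show ?case by (fact assms(1))
next
  case (update p m c)
  have "Poly_Mapping.update m c p = Poly_Mapping.single m c + p"
    by (rule poly_mapping_eqI)
      (use update(1) in \<open>auto simp: lookup_update lookup_add lookup_single in_keys_iff\<close>)
  then show ?case
    using assms(2)[OF update(3)] by simp
qed

text \<open>Both factors are built up from single terms, where the claim is \<open>monom_value_add\<close>.\<close>

lemma poly_value_mult: "poly_value x (p * q) = poly_value x p * poly_value x q"
proof (induction p rule: poly_mapping_add_single_induct)
  case zero
  show ?case by (simp add: poly_value_def)
next
  case (add m c p)
  have "poly_value x (Poly_Mapping.single m c * q) = c * monom_value x m * poly_value x q"
  proof (induction q rule: poly_mapping_add_single_induct)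
    case zero
    show ?case by (simp add: poly_value_def)
  next
    case (add m' c' q)
    then show ?case
      by (simp add: mult_single poly_value_add poly_value_single monom_value_add algebra_simps)
  qed
  with add show ?case
    by (simp add: distrib_right poly_value_add poly_value_single)
qed

lemma comm_ring_hom_poly_value: "comm_ring_hom (poly_value x)"
proof
  show "poly_value x 0 = 0" by (simp add: poly_value_def)
  show "poly_value x 1 = 1"
    using poly_value_single[of x 0 1] by (simp add: monom_value_def)
qed (simp_all add: poly_value_add poly_value_mult)

lemma poly_value_indet: "poly_value x (indet ij) = x ij"
  by (simp add: indet_def poly_value_single monom_value_def)

lemma map_mat_indet_mat:
  fixes B :: "real mat"
  assumes "B \<in> carrier_mat n m"
  shows "map_mat (poly_value (($$) B)) (indet_mat n m) = B"
  using assms by (intro eq_matI) (auto simp: indet_mat_def poly_value_indet)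

section \<open>The polynomials of a discriminantal arrangement under ring homomorphisms\<close>

lemma pick_less_of_index_sets:
  assumes "S \<in> index_sets n k" "t < k"
  shows "pick S t < n"
  using assms pick_in_set_le[of t S] by (auto simp: index_sets_def)

lemma index_sets_Collect_less:
  assumes "J \<in> index_sets n k"
  shows "{j. j < n \<and> j \<in> J} = J" "card J = k"
  using assms by (auto simp: index_sets_def)

text \<open>
  The restriction on \<open>S\<close> keeps all accessed entries inside the matrix; outside its dimensions
  \<open>map_mat\<close> need not agree with the homomorphism.
\<close>

lemma (in comm_ring_hom) disc_form_hom:
  assumes "S \<in> index_sets (dim_row X) (dim_col X + 1)" "dim_vec y = dim_row X"
  shows "disc_form (map_mat hom X) S (map_vec hom y) = hom (disc_form X S y)"
proof -
  have less: "pick S t < dim_row X" if "t < dim_col X + 1" for t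
    using pick_less_of_index_sets[OF assms(1) that] .
  show ?thesis
    unfolding disc_form_def hom_det[symmetric]
    by (rule arg_cong[where f = det], rule eq_matI) (use assms less in auto)
qed

lemma (in comm_ring_hom) sum_sq_minors_hom:
  assumes "set Ss \<subseteq> index_sets (dim_row X) (dim_col X + 1)"
  shows "sum_sq_minors (map_mat hom X) Ss = hom (sum_sq_minors X Ss)"
proof -
  have unit: "map_vec hom (unit_vec (dim_row X) k) = unit_vec (dim_row X) k" for k
    by (rule eq_vecI) (auto simp: unit_vec_def)
  have row: "disc_form (map_mat hom X) S (unit_vec (dim_row X) k) =
      hom (disc_form X S (unit_vec (dim_row X) k))" if "S \<in> set Ss" for S k
    using that assms disc_form_hom[of S X "unit_vec (dim_row X) k"] by (auto simp: unit)
  have disc: "disc_submatrix (map_mat hom X) Ss = map_mat hom (disc_submatrix X Ss)"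
    by (rule eq_matI) (auto simp: disc_submatrix_def mat_of_rows_def disc_row_def row)
  have "submatrix (disc_submatrix (map_mat hom X) Ss) UNIV J =
      map_mat hom (submatrix (disc_submatrix X Ss) UNIV J)" for J
    unfolding disc
    by (rule eq_matI) (auto simp: submatrix_def pick_le pick_UNIV)
  then show ?thesis
    by (simp add: sum_sq_minors_def hom_distribs)
qed

text \<open>The value of \<open>sum_sq_minors\<close> at \<open>B\<close> is the image of the polynomial under evaluation.\<close>

corollary sum_sq_minors_indet_mat_nonzero:
  fixes B :: "real mat"
  assumes "B \<in> carrier_mat n m" "set Ss \<subseteq> index_sets n (m + 1)" "sum_sq_minors B Ss \<noteq> 0"
  shows "sum_sq_minors (indet_mat n m) Ss \<noteq> 0"
proof -
  interpret comm_ring_hom "poly_value (($$) B)" by (rule comm_ring_hom_poly_value)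
  show ?thesis
    using sum_sq_minors_hom[of Ss "indet_mat n m"] map_mat_indet_mat[OF assms(1)] assms(2,3)
    by (auto simp: indet_mat_def)
qed

section \<open>Vanishing minors as linear dependences\<close>

lemma det_eq_zero_iff_row_relation:
  fixes M :: "'a :: field mat"
  assumes "M \<in> carrier_mat l l"
  shows "det M = 0 \<longleftrightarrow> (\<exists>c. (\<exists>s<l. c s \<noteq> 0) \<and> (\<forall>j<l. (\<Sum>s<l. c s * M $$ (s, j)) = 0))"
proof -
  have prod: "(M\<^sup>T *\<^sub>v v) $ j = (\<Sum>s<l. v $ s * M $$ (s, j))"
    if "v \<in> carrier_vec l" "j < l" for v j
    using assms that
    by (auto simp: scalar_prod_def mult.commute atLeast0LessThan intro!: sum.cong)
  have "det M = 0 \<longleftrightarrow> (\<exists>v. v \<in> carrier_vec l \<and> v \<noteq> 0\<^sub>v l \<and> M\<^sup>T *\<^sub>v v = 0\<^sub>v l)"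
    using det_0_iff_vec_prod_zero_field[of "M\<^sup>T" l] det_transpose[OF assms] assms by simp
  also have "\<dots> \<longleftrightarrow> (\<exists>c. (\<exists>s<l. c s \<noteq> 0) \<and> (\<forall>j<l. (\<Sum>s<l. c s * M $$ (s, j)) = 0))"
  proof
    assume "\<exists>v. v \<in> carrier_vec l \<and> v \<noteq> 0\<^sub>v l \<and> M\<^sup>T *\<^sub>v v = 0\<^sub>v l"
    then obtain v where v: "v \<in> carrier_vec l" "v \<noteq> 0\<^sub>v l" "M\<^sup>T *\<^sub>v v = 0\<^sub>v l"
      by blast
    then have "\<exists>s<l. v $ s \<noteq> 0"
      by (metis carrier_vecD eq_vecI index_zero_vec(1) index_zero_vec(2))
    moreover have "\<forall>j<l. (\<Sum>s<l. v $ s * M $$ (s, j)) = 0"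
      using prod[OF v(1)] v(3) by simp
    ultimately show "\<exists>c. (\<exists>s<l. c s \<noteq> 0) \<and> (\<forall>j<l. (\<Sum>s<l. c s * M $$ (s, j)) = 0)"
      by blast
  next
    assume "\<exists>c. (\<exists>s<l. c s \<noteq> 0) \<and> (\<forall>j<l. (\<Sum>s<l. c s * M $$ (s, j)) = 0)"
    then obtain c s where c: "s < l" "c s \<noteq> 0" "\<forall>j<l. (\<Sum>s<l. c s * M $$ (s, j)) = 0"
      by blast
    have "vec l c \<noteq> 0\<^sub>v l"
      using c(1,2) by (metis index_vec index_zero_vec(1))
    moreover have "M\<^sup>T *\<^sub>v vec l c = 0\<^sub>v l"
      by (rule eq_vecI) (use c(3) prod[of "vec l c"] assms in auto)
    ultimately show "\<exists>v. v \<in> carrier_vec l \<and> v \<noteq> 0\<^sub>v l \<and> M\<^sup>T *\<^sub>v v = 0\<^sub>v l"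
      using vec_carrier by blast
  qed
  finally show ?thesis .
qed

text \<open>
  A sum of real squares vanishes only if every minor does, and each minor is singular exactly if its
  rows are dependent. The coefficients of the dependence may vary with \<open>J\<close>. Indexing the columns by
  the elements of \<open>J\<close> instead of their ranks frees later arguments from the order of the indices.
\<close>

lemma sum_sq_minors_eq_zero_iff:
  fixes X :: "real mat"
  shows "sum_sq_minors X Ss = 0 \<longleftrightarrow> (\<forall>J\<in>index_sets (dim_row X) (length Ss).
    \<exists>c. (\<exists>s<length Ss. c s \<noteq> 0) \<and>
      (\<forall>k\<in>J. (\<Sum>s<length Ss. c s * disc_form X (Ss ! s) (unit_vec (dim_row X) k)) = 0))"
proof -
  let ?n = "dim_row X" and ?l = "length Ss"
  have minor: "det (submatrix (disc_submatrix X Ss) UNIV J) = 0 \<longleftrightarrow>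
      (\<exists>c. (\<exists>s<?l. c s \<noteq> 0) \<and> (\<forall>k\<in>J. (\<Sum>s<?l. c s * disc_form X (Ss ! s) (unit_vec ?n k)) = 0))"
    if J: "J \<in> index_sets ?n ?l" for J
  proof -
    let ?M = "submatrix (disc_submatrix X Ss) UNIV J"
    note J' = index_sets_Collect_less[OF J]
    have M: "?M \<in> carrier_mat ?l ?l"
      using J' by (simp add: submatrix_def disc_submatrix_def)
    have entry: "?M $$ (s, j) = disc_form X (Ss ! s) (unit_vec ?n (pick J j))"
      if "s < ?l" "j < ?l" for s j
      using that J' pick_less_of_index_sets[OF J]
      by (simp add: submatrix_def disc_submatrix_def mat_of_rows_def disc_row_def pick_UNIV)
    have J_eq: "J = pick J ` {..<?l}"
    proof
      show "pick J ` {..<?l} \<subseteq> J"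
        using pick_in_set_le[of _ J] J'(2) by auto
      have "finite J"
        using J by (auto simp: index_sets_def intro: finite_subset)
      show "J \<subseteq> pick J ` {..<?l}"
      proof
        fix k assume k: "k \<in> J"
        have "{a \<in> J. a < k} \<subset> J" using k by auto
        then have "card {a \<in> J. a < k} < ?l"
          using psubset_card_mono[OF \<open>finite J\<close>] J'(2) by metis
        then show "k \<in> pick J ` {..<?l}"
          by (intro image_eqI[of k "pick J", OF pick_card_in_set[OF k, symmetric]]) simp
      qed
    qed
    have ball: "(\<forall>k\<in>J. P k) \<longleftrightarrow> (\<forall>j<?l. P (pick J j))" for P
      by (subst J_eq) auto
    show ?thesis
      unfolding det_eq_zero_iff_row_relation[OF M] ball by (simp add: entry)
  qed
  have "finite (index_sets ?n ?l)"
    by (simp add: index_sets_def)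
  then show ?thesis
    by (simp add: sum_sq_minors_def sum_nonneg_eq_0_iff minor cong: ball_cong)
qed

section \<open>Triples of lines in the plane\<close>

definition minor2 :: "'a :: comm_ring_1 mat \<Rightarrow> nat \<Rightarrow> nat \<Rightarrow> 'a" where
  "minor2 X i j = X $$ (i, 0) * X $$ (j, 1) - X $$ (i, 1) * X $$ (j, 0)"

text \<open>
  This is \<open>disc_form\<close> on \<open>{i, j, k}\<close> with the rows in the given order instead of increasing order,
  expanded along the last column.
\<close>

definition triple_form :: "'a :: comm_ring_1 mat \<Rightarrow> nat \<Rightarrow> nat \<Rightarrow> nat \<Rightarrow> 'a vec \<Rightarrow> 'a" where
  "triple_form X i j k y = y $ i * minor2 X j k + y $ j * minor2 X k i + y $ k * minor2 X i j"

lemma det_mat_3: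
  "det (mat 3 3 f :: 'a :: comm_ring_1 mat) =
    f (0, 2) * (f (1, 0) * f (2, 1) - f (1, 1) * f (2, 0))
    - f (1, 2) * (f (0, 0) * f (2, 1) - f (0, 1) * f (2, 0))
    + f (2, 2) * (f (0, 0) * f (1, 1) - f (0, 1) * f (1, 0))"
proof -
  have det2: "det (mat 2 2 g :: 'a mat) = g (0, 0) * g (1, 1) - g (0, 1) * g (1, 0)" for g
    by (subst laplace_expansion_column[of _ 2 0])
      (simp_all add: numeral_2_eq_2 lessThan_Suc cofactor_def mat_delete_def det_single)
  show ?thesis
    by (subst laplace_expansion_column[of _ 3 2])
      (simp_all add: eval_nat_numeral lessThan_Suc cofactor_def mat_delete_def
        det2[unfolded numeral_2_eq_2] algebra_simps)
qed

lemma disc_form_sorted_triple: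
  assumes "dim_col X = 2" "i < j" "j < k"
  shows "disc_form X {i, j, k} y = triple_form X i j k y"
proof -
  let ?S = "{i, j, k}"
  have "{a \<in> ?S. a < i} = {}" "{a \<in> ?S. a < j} = {i}" "{a \<in> ?S. a < k} = {i, j}"
    using assms by auto
  then have "card {a \<in> ?S. a < i} = 0" "card {a \<in> ?S. a < j} = 1" "card {a \<in> ?S. a < k} = 2"
    using assms by simp_all
  then have "pick ?S 0 = i" "pick ?S 1 = j" "pick ?S 2 = k"
    by (metis pick_card_in_set insertCI)+
  then show ?thesis
    using assms(1)
    by (simp add: disc_form_def det_mat_3 triple_form_def minor2_def del: pick.simps)
      (simp add: algebra_simps)
qed

text \<open>
  Sorting the rows costs a sign, the same for all \<open>y\<close>. This uniformity lets the sign be absorbed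
  into the coefficients of a linear relation between the forms.
\<close>

lemma disc_form_triple:
  fixes X :: "'a :: comm_ring_1 mat"
  assumes "dim_col X = 2" "i \<noteq> j" "j \<noteq> k" "i \<noteq> k"
  shows "\<exists>\<sigma>\<in>{1, -1}. \<forall>y. disc_form X {i, j, k} y = \<sigma> * triple_form X i j k y"
proof -
  have by_order: ?thesis
    if "a < b" "b < c" "{i, j, k} = {a, b, c}" "\<sigma> \<in> {1, -1}"
      "\<And>y. triple_form X a b c y = \<sigma> * triple_form X i j k y" for a b c \<sigma>
    using disc_form_sorted_triple[OF assms(1) that(1,2)] that(3-5) by metis
  have perm:
    "triple_form X i k j y = -1 * triple_form X i j k y"
    "triple_form X j i k y = -1 * triple_form X i j k y"
    "triple_form X k j i y = -1 * triple_form X i j k y"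
    "triple_form X i j k y = 1 * triple_form X i j k y"
    "triple_form X j k i y = 1 * triple_form X i j k y"
    "triple_form X k i j y = 1 * triple_form X i j k y" for y
    by (simp_all add: triple_form_def minor2_def algebra_simps)
  consider "i < j" "j < k" | "i < k" "k < j" | "j < i" "i < k"
    | "j < k" "k < i" | "k < i" "i < j" | "k < j" "j < i"
    using assms by linarith
  then show ?thesis
  proof cases
    case 1
    show ?thesis by (rule by_order[OF 1 _ _ perm(4)]) auto
  next
    case 2
    show ?thesis by (rule by_order[OF 2 _ _ perm(1)]) auto
  next
    case 3
    show ?thesis by (rule by_order[OF 3 _ _ perm(2)]) auto
  next
    case 4
    show ?thesis by (rule by_order[OF 4 _ _ perm(5)]) auto
  next
    case 5
    show ?thesis by (rule by_order[OF 5 _ _ perm(6)]) auto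
  next
    case 6
    show ?thesis by (rule by_order[OF 6 _ _ perm(3)]) auto
  qed
qed

section \<open>The complete quadrilateral of altitudes\<close>

text \<open>
  For a triangle with sides \<open>p\<close>, \<open>q\<close>, \<open>r\<close> and altitudes \<open>p'\<close>, \<open>q'\<close>, \<open>r'\<close> on these sides, the four
  triples are the lines through the orthocentre and through the three vertices.
\<close>

definition altitude_triples :: "nat \<Rightarrow> nat \<Rightarrow> nat \<Rightarrow> nat \<Rightarrow> nat \<Rightarrow> nat \<Rightarrow> nat set list" where
  "altitude_triples p p' q q' r r' = [{p', q', r'}, {p', q, r}, {q', r, p}, {r', p, q}]"

lemma altitude_triples_distinct:
  assumes "distinct [p, p', q, q', r, r']"
  shows "distinct (altitude_triples p p' q q' r r')"
proof -
  \<comment> \<open>The sides \<open>p\<close> and \<open>q\<close> alone tell the four points apart.\<close>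
  have "distinct (map (\<lambda>S. (p \<in> S, q \<in> S)) (altitude_triples p p' q q' r r'))"
    using assms by (auto simp: altitude_triples_def)
  then show ?thesis
    by (simp add: distinct_map)
qed

lemma altitude_triples_index_sets:
  assumes "distinct [p, p', q, q', r, r']" "set [p, p', q, q', r, r'] \<subseteq> {..<n}"
  shows "set (altitude_triples p p' q q' r r') \<subseteq> index_sets n 3"
  using assms by (auto simp: altitude_triples_def index_sets_def)

lemma sum_sq_minors_altitude_triples_eq_zero_iff:
  fixes X :: "real mat"
  assumes X: "X \<in> carrier_mat n 2" and distinct: "distinct [p, p', q, q', r, r']"
  shows "sum_sq_minors X (altitude_triples p p' q q' r r') = 0 \<longleftrightarrow>
    (\<forall>J\<in>index_sets n 4. \<exists>a b c d. (a \<noteq> 0 \<or> b \<noteq> 0 \<or> c \<noteq> 0 \<or> d \<noteq> 0) \<and>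
      (\<forall>k\<in>J. a * triple_form X p' q' r' (unit_vec n k) + b * triple_form X p' q r (unit_vec n k)
        + c * triple_form X q' r p (unit_vec n k) + d * triple_form X r' p q (unit_vec n k) = 0))"
proof -
  have dims: "dim_row X = n" "dim_col X = 2"
    using X by auto
  have neq: "p' \<noteq> q'" "q' \<noteq> r'" "p' \<noteq> r'" "p' \<noteq> q" "q \<noteq> r" "p' \<noteq> r"
    "q' \<noteq> r" "r \<noteq> p" "q' \<noteq> p" "r' \<noteq> p" "p \<noteq> q" "r' \<noteq> q"
    using distinct by auto
  obtain \<sigma>0 \<sigma>1 \<sigma>2 \<sigma>3 where \<sigma>:
    "\<sigma>0 \<in> {1, -1}" "\<forall>y. disc_form X {p', q', r'} y = \<sigma>0 * triple_form X p' q' r' y"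
    "\<sigma>1 \<in> {1, -1}" "\<forall>y. disc_form X {p', q, r} y = \<sigma>1 * triple_form X p' q r y"
    "\<sigma>2 \<in> {1, -1}" "\<forall>y. disc_form X {q', r, p} y = \<sigma>2 * triple_form X q' r p y"
    "\<sigma>3 \<in> {1, -1}" "\<forall>y. disc_form X {r', p, q} y = \<sigma>3 * triple_form X r' p q y"
    using disc_form_triple[OF dims(2) neq(1-3)] disc_form_triple[OF dims(2) neq(4-6)]
      disc_form_triple[OF dims(2) neq(7-9)] disc_form_triple[OF dims(2) neq(10-12)]
    by meson
  have sq: "\<sigma>0 * \<sigma>0 = 1" "\<sigma>1 * \<sigma>1 = 1" "\<sigma>2 * \<sigma>2 = 1" "\<sigma>3 * \<sigma>3 = 1"
    using \<sigma>(1,3,5,7) by auto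
  have coeffs: "(\<exists>c. (\<exists>s<4. c s \<noteq> 0) \<and>
      (\<forall>k\<in>J. (\<Sum>s<4. c s * disc_form X (altitude_triples p p' q q' r r' ! s) (unit_vec n k)) = 0)) \<longleftrightarrow>
    (\<exists>a b c d. (a \<noteq> 0 \<or> b \<noteq> 0 \<or> c \<noteq> 0 \<or> d \<noteq> 0) \<and>
      (\<forall>k\<in>J. a * triple_form X p' q' r' (unit_vec n k) + b * triple_form X p' q r (unit_vec n k)
        + c * triple_form X q' r p (unit_vec n k) + d * triple_form X r' p q (unit_vec n k) = 0))"
    (is "?L \<longleftrightarrow> ?R") for J
  proof
    assume ?L
    then obtain c :: "nat \<Rightarrow> real" where c: "\<exists>s<4. c s \<noteq> 0"
      "\<forall>k\<in>J. (\<Sum>s<4. c s * disc_form X (altitude_triples p p' q q' r r' ! s) (unit_vec n k)) = 0"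
      by blast
    show ?R
      by (rule exI[of _ "c 0 * \<sigma>0"], rule exI[of _ "c 1 * \<sigma>1"], rule exI[of _ "c 2 * \<sigma>2"],
          rule exI[of _ "c 3 * \<sigma>3"])
        (use c sq in \<open>auto simp: altitude_triples_def \<sigma>(2,4,6,8) eval_nat_numeral less_Suc_eq
          algebra_simps\<close>)
  next
    assume ?R
    then obtain a b c d where abcd: "a \<noteq> 0 \<or> b \<noteq> 0 \<or> c \<noteq> 0 \<or> d \<noteq> 0"
      "\<forall>k\<in>J. a * triple_form X p' q' r' (unit_vec n k) + b * triple_form X p' q r (unit_vec n k)
        + c * triple_form X q' r p (unit_vec n k) + d * triple_form X r' p q (unit_vec n k) = 0"
      by blast
    have cancel: "x * \<sigma> * (\<sigma> * t) = x * t" if "\<sigma> * \<sigma> = 1" for x \<sigma> t :: real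
      using that by (metis mult.assoc mult.right_neutral)
    show ?L
      by (rule exI[of _ "(!) [a * \<sigma>0, b * \<sigma>1, c * \<sigma>2, d * \<sigma>3]"])
        (use abcd sq in \<open>auto simp: altitude_triples_def \<sigma>(2,4,6,8) eval_nat_numeral less_Suc_eq
          cancel ex_disj_distrib conj_disj_distribR\<close>)
  qed
  have "length (altitude_triples p p' q q' r r') = 4"
    by (simp add: altitude_triples_def)
  then show ?thesis
    by (simp add: sum_sq_minors_eq_zero_iff dims coeffs del: One_nat_def)
qed

text \<open>
  This is the concurrence of the altitudes: the row of each altitude is a multiple of the row of its
  side turned by a right angle. The coefficient of \<open>y $ p\<close> cancels between the two vertices on side
  \<open>p\<close>, because \<open>minor2 X q' r\<close> is \<open>-\<beta>\<close> times, and \<open>minor2 X q r'\<close> is \<open>\<gamma>\<close> times, the scalar product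
  of rows \<open>q\<close> and \<open>r\<close>; likewise for \<open>q\<close> and \<open>r\<close>. What is left involves only the altitudes. The
  weights are the products of two scale factors that homogeneity demands, with no division, so that
  zero factors are allowed.
\<close>

lemma altitude_relation:
  fixes X :: "'a :: comm_ring_1 mat"
  assumes "X $$ (p', 0) = - \<alpha> * X $$ (p, 1)" "X $$ (p', 1) = \<alpha> * X $$ (p, 0)"
    and "X $$ (q', 0) = - \<beta> * X $$ (q, 1)" "X $$ (q', 1) = \<beta> * X $$ (q, 0)"
    and "X $$ (r', 0) = - \<gamma> * X $$ (r, 1)" "X $$ (r', 1) = \<gamma> * X $$ (r, 0)"
  shows "triple_form X p' q' r' y =
    \<beta> * \<gamma> * triple_form X p' q r y + \<gamma> * \<alpha> * triple_form X q' r p y + \<alpha> * \<beta> * triple_form X r' p q y"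
  unfolding triple_form_def minor2_def assms by (simp add: algebra_simps)

text \<open>
  In the plane the vectors orthogonal to a nonzero vector form the line spanned by its rotation by a
  right angle.
\<close>

lemma perpendicular_row:
  fixes X :: "real mat"
  assumes "X \<in> carrier_mat n 2" "i < n" "j < n" "row X i \<noteq> 0\<^sub>v 2" "row X i \<bullet> row X j = 0"
  shows "\<exists>\<alpha>. X $$ (j, 0) = - \<alpha> * X $$ (i, 1) \<and> X $$ (j, 1) = \<alpha> * X $$ (i, 0)"
proof -
  define u v where "u = X $$ (i, 0)" and "v = X $$ (i, 1)"
  have "u \<noteq> 0 \<or> v \<noteq> 0"
  proof (rule ccontr)
    assume "\<not> (u \<noteq> 0 \<or> v \<noteq> 0)"
    then have "row X i = 0\<^sub>v 2"
      using assms(1,2) by (intro eq_vecI) (auto simp: u_def v_def less_2_cases_iff)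
    with assms(4) show False by simp
  qed
  then have pos: "u\<^sup>2 + v\<^sup>2 \<noteq> 0"
    by (simp add: sum_power2_eq_zero_iff)
  have orth: "u * X $$ (j, 0) + v * X $$ (j, 1) = 0"
    using assms by (simp add: scalar_prod_def numeral_2_eq_2 u_def v_def)
  have "X $$ (j, 0) * (u\<^sup>2 + v\<^sup>2) = - (u * X $$ (j, 1) - v * X $$ (j, 0)) * v"
    "X $$ (j, 1) * (u\<^sup>2 + v\<^sup>2) = (u * X $$ (j, 1) - v * X $$ (j, 0)) * u"
    using arg_cong[OF orth, of "(*) u"] arg_cong[OF orth, of "(*) v"]
    by (simp_all add: algebra_simps power2_eq_square)
  then show ?thesis
    using pos unfolding u_def[symmetric] v_def[symmetric]
    by (intro exI[of _ "(u * X $$ (j, 1) - v * X $$ (j, 0)) / (u\<^sup>2 + v\<^sup>2)"])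
      (simp add: field_simps)
qed

lemma sum_sq_minors_altitude_triples_perpendicular:
  fixes A :: "real mat"
  assumes "A \<in> carrier_mat n 2" "distinct [p, p', q, q', r, r']" "set [p, p', q, q', r, r'] \<subseteq> {..<n}"
    and "row A p \<noteq> 0\<^sub>v 2" "row A q \<noteq> 0\<^sub>v 2" "row A r \<noteq> 0\<^sub>v 2"
    and "row A p \<bullet> row A p' = 0" "row A q \<bullet> row A q' = 0" "row A r \<bullet> row A r' = 0"
  shows "sum_sq_minors A (altitude_triples p p' q q' r r') = 0"
proof -
  obtain \<alpha> \<beta> \<gamma> where
    "A $$ (p', 0) = - \<alpha> * A $$ (p, 1)" "A $$ (p', 1) = \<alpha> * A $$ (p, 0)"
    "A $$ (q', 0) = - \<beta> * A $$ (q, 1)" "A $$ (q', 1) = \<beta> * A $$ (q, 0)"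
    "A $$ (r', 0) = - \<gamma> * A $$ (r, 1)" "A $$ (r', 1) = \<gamma> * A $$ (r, 0)"
    using perpendicular_row[OF assms(1), of p p'] perpendicular_row[OF assms(1), of q q']
      perpendicular_row[OF assms(1), of r r'] assms(3-) by auto
  note relation = altitude_relation[OF this]
  \<comment> \<open>The coefficient \<open>-1\<close> makes the relation nontrivial whatever the scale factors are.\<close>
  have "- 1 * triple_form A p' q' r' y + \<beta> * \<gamma> * triple_form A p' q r y
      + \<gamma> * \<alpha> * triple_form A q' r p y + \<alpha> * \<beta> * triple_form A r' p q y = 0" for y
    unfolding relation by simp
  then show ?thesis
    unfolding sum_sq_minors_altitude_triples_eq_zero_iff[OF assms(1,2)]
    by (metis zero_neq_neg_one)
qed

text \<open>
  The specialisation \<open>p = p' = (0, 1)\<close>, \<open>q = (1, 1)\<close>, \<open>q' = r = r' = (1, 0)\<close> makes the coefficients of a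
  relation vanish one after another: as \<open>q'\<close> and \<open>r'\<close> are parallel, column \<open>p'\<close> forces \<open>b = 0\<close>; as
  \<open>q'\<close> and \<open>r\<close> are parallel, column \<open>p\<close> forces \<open>d = 0\<close>; then column \<open>r'\<close> gives \<open>a = 0\<close> and column
  \<open>q'\<close> gives \<open>c = 0\<close>.
\<close>

lemma sum_sq_minors_altitude_triples_indet_mat:
  assumes distinct: "distinct [p, p', q, q', r, r']"
    and less: "set [p, p', q, q', r, r'] \<subseteq> {..<n}"
  shows "sum_sq_minors (indet_mat n 2) (altitude_triples p p' q q' r r') \<noteq> 0"
proof -
  define B :: "real mat" where
    "B = mat n 2 (\<lambda>(i, j). if i \<in> {p, p'} then (if j = 0 then 0 else 1)
      else if i = q then 1 else (if j = 0 then 1 else 0))"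
  have B: "B \<in> carrier_mat n 2"
    by (simp add: B_def)
  have entries:
    "B $$ (p, 0) = 0" "B $$ (p, 1) = 1" "B $$ (p', 0) = 0" "B $$ (p', 1) = 1"
    "B $$ (q, 0) = 1" "B $$ (q, 1) = 1" "B $$ (q', 0) = 1" "B $$ (q', 1) = 0"
    "B $$ (r, 0) = 1" "B $$ (r, 1) = 0" "B $$ (r', 0) = 1" "B $$ (r', 1) = 0"
    using distinct less by (auto simp: B_def)
  let ?J = "{p, p', q', r'}"
  have J: "?J \<in> index_sets n 4"
    using distinct less by (auto simp: index_sets_def)
  \<comment> \<open>The simplifier needs each inequality in both orientations to evaluate the unit vectors.\<close>
  have distinct': "distinct [r', r, q', q, p', p]"
    using distinct by auto
  have "a = 0 \<and> b = 0 \<and> c = 0 \<and> d = 0"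
    if "\<forall>k\<in>?J. a * triple_form B p' q' r' (unit_vec n k) + b * triple_form B p' q r (unit_vec n k)
        + c * triple_form B q' r p (unit_vec n k) + d * triple_form B r' p q (unit_vec n k) = 0"
    for a b c d
    using that distinct distinct' less
    by (auto simp: triple_form_def minor2_def entries simp del: One_nat_def)
  then have "sum_sq_minors B (altitude_triples p p' q q' r r') \<noteq> 0"
    unfolding sum_sq_minors_altitude_triples_eq_zero_iff[OF B distinct] using J by blast
  then show ?thesis
    using sum_sq_minors_indet_mat_nonzero[OF B] altitude_triples_index_sets[OF distinct less] by simp
qed

section \<open>Six lines in three perpendicular pairs\<close>

lemma generic_row_nonzero:
  assumes "generic A" "i < dim_row A" "0 < dim_col A"
  shows "row A i \<noteq> 0\<^sub>v (dim_col A)"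
proof
  assume zero: "row A i = 0\<^sub>v (dim_col A)"
  interpret vec_module "TYPE(real)" "dim_col A" .
  have "row A i \<in> set (rows A)"
    using assms(2) by (auto simp: rows_def)
  then have "\<not> lin_dep {0\<^sub>v (dim_col A)}"
    using assms(1,3) zero unfolding generic_def by simp
  moreover have "(UNIV :: real set) \<noteq> {0}"
    by (metis UNIV_I singletonD zero_neq_one)
  ultimately show False
    using zero_nin_lin_indpt[of "{0\<^sub>v (dim_col A)}"] by auto
qed

lemma three_perpendicular_pairsE:
  assumes "three_perpendicular_pairs A"
  obtains p p' q q' r r' where
    "distinct [p, p', q, q', r, r']" "set [p, p', q, q', r, r'] \<subseteq> {..<dim_row A}"
    "row A p \<bullet> row A p' = 0" "row A q \<bullet> row A q' = 0" "row A r \<bullet> row A r' = 0"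
proof -
  obtain Q where Q: "partition_on {..<dim_row A} Q" "card Q = 3"
    "\<forall>P\<in>Q. \<exists>i j. i \<noteq> j \<and> P = {i, j} \<and> row A i \<bullet> row A j = 0"
    using assms by (auto simp: three_perpendicular_pairs_def)
  from Q(2) obtain P1 P2 P3 where P: "Q = {P1, P2, P3}" "P1 \<noteq> P2" "P2 \<noteq> P3" "P1 \<noteq> P3"
    by (auto simp: card_3_iff)
  then have disjoint: "P1 \<inter> P2 = {}" "P2 \<inter> P3 = {}" "P1 \<inter> P3 = {}"
    and union: "P1 \<union> P2 \<union> P3 = {..<dim_row A}"
    using Q(1) by (auto simp: partition_on_def disjoint_def)
  obtain p p' where p: "p \<noteq> p'" "P1 = {p, p'}" "row A p \<bullet> row A p' = 0"
    using Q(3) P(1) by blast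
  obtain q q' where q: "q \<noteq> q'" "P2 = {q, q'}" "row A q \<bullet> row A q' = 0"
    using Q(3) P(1) by blast
  obtain r r' where r: "r \<noteq> r'" "P3 = {r, r'}" "row A r \<bullet> row A r' = 0"
    using Q(3) P(1) by blast
  show ?thesis
    by (rule that[of p p' q q' r r']) (use p q r disjoint union in auto)
qed

theorem theoremA:
  fixes A :: "real mat"
  assumes "A \<in> carrier_mat 6 2"
    and "generic A"
    and "three_perpendicular_pairs A"
  shows "\<not> very_generic A"
proof
  assume "very_generic A"
  have dims: "dim_row A = 6" "dim_col A = 2"
    using assms(1) by auto
  obtain p p' q q' r r' where
    distinct: "distinct [p, p', q, q', r, r']" and less: "set [p, p', q, q', r, r'] \<subseteq> {..<6}"
    and perp: "row A p \<bullet> row A p' = 0" "row A q \<bullet> row A q' = 0" "row A r \<bullet> row A r' = 0"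
    using three_perpendicular_pairsE[OF assms(3)] dims by metis
  let ?Ss = "altitude_triples p p' q q' r r'"
  have nonzero: "row A i \<noteq> 0\<^sub>v 2" if "i < 6" for i
    using generic_row_nonzero[OF assms(2), of i] that dims by simp
  have "sum_sq_minors A ?Ss = 0"
    using less by (intro sum_sq_minors_altitude_triples_perpendicular[OF assms(1) distinct less]
        nonzero perp) auto
  moreover have "sum_sq_minors A ?Ss \<noteq> 0"
    using \<open>very_generic A\<close> altitude_triples_distinct[OF distinct]
      altitude_triples_index_sets[OF distinct less]
      sum_sq_minors_altitude_triples_indet_mat[OF distinct less]
    by (simp add: very_generic_def dims)
  ultimately show False by contradiction
qed

end
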